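(* Let $P$ be a training set in a doubling metric space $(\mathcal{X},\mathsf{d})$ with margin $\gamma$ and with $\kappa$ nearest-enemy points, and let $\alpha\ge0$. The algorithm $\alpha$-SFCNN selects $$\mathcal{O}\!\left(\kappa\,\log\tfrac1\gamma\,(1+\alpha)^{\mathrm{ddim}(\mathcal{X})+1}\right)$$ points.
   Context: A training set is a finite set $P$ of points of a metric space $(\mathcal{X},\mathsf{d})$, partitioned into a finite set of classes by associating each $p\in P$ with a label $l(p)$. By scaling, the diameter of $P$ is assumed to be $1$. For $p\in P$, the nearest-enemy $\mathrm{ne}(p)$ is the closest point of $P$ whose label differs from $l(p)$. Define $\kappa=|\{\mathrm{ne}(p)\mid p\in P\}|$ and the margin $\gamma=\min_{p\in P}\mathsf{d}(p,\mathrm{ne}(p))$. For $p\in P$ and nonempty $R\subseteq P$, $\mathrm{nn}(p,R)$ is the nearest-neighbor of $p$ in $R$, $\mathsf{d}_{\mathrm{nn}}(p,R)$ is the distance from $p$ to it, and $\mathsf{d}_{\mathrm{ne}}(p,R)$ is the distance from $p$ to the closest point of $R$ whose label differs from $l(p)$ ($+\infty$ if there is none). The chromatic density of $p$ with respect to $R$ is $\delta(p,R)=\mathsf{d}_{\mathrm{ne}}(p,R)/\mathsf{d}_{\mathrm{nn}}(p,R)-1$ ($+\infty$ if $\mathsf{d}_{\mathrm{nn}}(p,R)=0$). The space is doubling if there is a bounded value $\lambda$ such that any metric ball of radius $r$ can be covered with at most $\lambda$ metric balls of radius $r/2$; its doubling dimension is $\mathrm{ddim}(\mathcal{X})=\log_2\lambda$,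 assumed to be a constant, so multiplicative factors depending on it may be hidden in the asymptotic notation. For $p\in R\subseteq P$ let $\mathrm{voren}_\alpha(p,R,P)=\{q\in P\mid \mathrm{nn}(q,R)=p\ \wedge\ (l(q)=l(p)\Rightarrow\delta(q,R)<\alpha)\}$. Algorithm $\alpha$-SFCNN: set $R=\emptyset$ and let $S$ consist of one point per class (the centroids of the classes of $P$). While $S\ne\emptyset$: add to $R$ one point chosen from $S$; then reset $S=\emptyset$ and, for each $p\in R$ with $\mathrm{voren}_\alpha(p,R,P)\neq\emptyset$, add to $S$ one point chosen from $\mathrm{voren}_\alpha(p,R,P)$. Return $R$. The points selected are those of the returned $R$.
   Formalization: log(1/γ) is replaced by max(1, log₂(1/γ)), since the printed bound is 0 at γ = 1 and fails for every constant as γ → 1. The constant depends on an upper bound for ddim and serves all spaces carried by one fixed set; the reals cover every doubling space. *)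

theory Defs
  imports "HOL-Analysis.Analysis"
begin

context Metric_space
begin

text \<open>Balls are closed and, as \<open>mcball\<close> is empty for centers outside \<open>M\<close>, centered in the
  space.\<close>

definition doubling_with :: "nat \<Rightarrow> bool" where
  "doubling_with lam \<longleftrightarrow>
     (\<forall>x\<in>M. \<forall>r>0. \<exists>T\<subseteq>M. finite T \<and> card T \<le> lam \<and> mcball x r \<subseteq> (\<Union>t\<in>T. mcball t (r / 2)))"

definition doubling :: bool where
  "doubling \<longleftrightarrow> (\<exists>lam. doubling_with lam)"

definition ddim :: real where
  "ddim = log 2 (real (LEAST lam. doubling_with lam))"

end

text \<open>Neither nearest enemies nor nearest neighbors need be unique. The functions \<open>ne\<close> and
  \<open>nn\<close> are arbitrary tie-breaking choices of them. The assumptions on \<open>ne\<close> imply that there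
  are at least two classes, so that every point has an enemy.\<close>

locale training_set = Metric_space M d
  for M :: "'a set" and d :: "'a \<Rightarrow> 'a \<Rightarrow> real" +
  fixes P :: "'a set"
    and l :: "'a \<Rightarrow> 'c"
    and ne :: "'a \<Rightarrow> 'a"
    and nn :: "'a \<Rightarrow> 'a set \<Rightarrow> 'a"
  assumes P_subset: "P \<subseteq> M"
    and P_finite: "finite P"
    and P_nonempty: "P \<noteq> {}"
    and P_diameter: "(SUP (p, q) \<in> P \<times> P. d p q) = 1"
    and ne_enemy: "\<And>p. p \<in> P \<Longrightarrow> ne p \<in> P \<and> l (ne p) \<noteq> l p"
    and ne_nearest: "\<And>p q. p \<in> P \<Longrightarrow> q \<in> P \<Longrightarrow> l q \<noteq> l p \<Longrightarrow> d p (ne p) \<le> d p q"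
    and nn_in: "\<And>p R. p \<in> P \<Longrightarrow> R \<subseteq> P \<Longrightarrow> R \<noteq> {} \<Longrightarrow> nn p R \<in> R"
    and nn_nearest: "\<And>p R q. p \<in> P \<Longrightarrow> R \<subseteq> P \<Longrightarrow> q \<in> R \<Longrightarrow> d p (nn p R) \<le> d p q"
begin

definition kappa :: nat where
  "kappa = card (ne ` P)"

definition margin :: real where
  "margin = (MIN p\<in>P. d p (ne p))"

definition d_nn :: "'a \<Rightarrow> 'a set \<Rightarrow> real" where
  "d_nn p R = d p (nn p R)"

text \<open>The infimum of the empty set is \<open>\<infinity>\<close> in \<^typ>\<open>ereal\<close>.\<close>

definition d_ne :: "'a \<Rightarrow> 'a set \<Rightarrow> ereal" where
  "d_ne p R = (INF q\<in>{q \<in> R. l q \<noteq> l p}. ereal (d p q))"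

definition chromatic_density :: "'a \<Rightarrow> 'a set \<Rightarrow> ereal" where
  "chromatic_density p R = (if d_nn p R = 0 then \<infinity> else d_ne p R / ereal (d_nn p R) - 1)"

definition voren :: "real \<Rightarrow> 'a \<Rightarrow> 'a set \<Rightarrow> 'a set" where
  "voren \<alpha> p R =
     {q \<in> P. nn q R = p \<and> (l q = l p \<longrightarrow> chromatic_density q R < ereal \<alpha>)}"

text \<open>\<open>sfcnn_state \<alpha> R S\<close> holds if some run of the algorithm reaches the loop test with these
  values of \<open>R\<close> and \<open>S\<close>. All choices of points are nondeterministic; in particular the
  class representatives \<open>c\<close>, which in the algorithm are the centroids, may be any points of the
  classes.\<close>

inductive sfcnn_state :: "real \<Rightarrow> 'a set \<Rightarrow> 'a set \<Rightarrow> bool" for \<alpha> :: real where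
  init: "(\<And>k. k \<in> l ` P \<Longrightarrow> c k \<in> P \<and> l (c k) = k) \<Longrightarrow> sfcnn_state \<alpha> {} (c ` l ` P)"
| step: "sfcnn_state \<alpha> R S \<Longrightarrow> x \<in> S \<Longrightarrow> R' = insert x R \<Longrightarrow>
         (\<And>p. p \<in> R' \<Longrightarrow> voren \<alpha> p R' \<noteq> {} \<Longrightarrow> f p \<in> voren \<alpha> p R') \<Longrightarrow>
         sfcnn_state \<alpha> R' (f ` {p \<in> R'. voren \<alpha> p R' \<noteq> {}})"

definition sfcnn_returns :: "real \<Rightarrow> 'a set \<Rightarrow> bool" where
  "sfcnn_returns \<alpha> R \<longleftrightarrow> sfcnn_state \<alpha> R {}"

end

end

theory Submission
  imports Defs
begin

text \<open>A point \<open>x\<close> enters \<open>R\<close> only if \<open>(1 + \<alpha>) d(x, y) \<ge> d(x, ne x)\<close> for all \<open>y\<close> already in \<open>R\<close>: this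
  is clear if its nearest neighbor in \<open>R\<close> is an enemy, and otherwise it restates \<open>\<delta>(x, R) < \<alpha>\<close>.
  Hence the selected points with nearest enemy \<open>q\<close> at distance in \<open>(r/2, r]\<close> from \<open>q\<close> are more
  than \<open>r/(2(1 + \<alpha>))\<close> apart, and by doubling there are \<open>O((1 + \<alpha>)^ddim)\<close> of them. Summing over
  the \<open>\<kappa>\<close> choices of \<open>q\<close> and the \<open>O(log(1/\<gamma>))\<close> dyadic scales \<open>r\<close> gives the bound.\<close>

section \<open>Covering and packing in doubling spaces\<close>

context Metric_space
begin

text \<open>Induction on \<open>k\<close>: each ball of the cover at scale \<open>r / 2 ^ k\<close>
  is replaced by a cover of its own at half that radius, so the cardinalities multiply.\<close>

lemma doubling_cover_power:
  assumes lam: "doubling_with lam" and x: "x \<in> M" and r: "r > 0"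
  shows "\<exists>T\<subseteq>M. finite T \<and> card T \<le> lam ^ k \<and> mcball x r \<subseteq> (\<Union>t\<in>T. mcball t (r / 2 ^ k))"
proof (induction k)
  case 0
  show ?case using x by (intro exI[of _ "{x}"]) auto
next
  case (Suc k)
  then obtain T where T: "T \<subseteq> M" "finite T" "card T \<le> lam ^ k"
      "mcball x r \<subseteq> (\<Union>t\<in>T. mcball t (r / 2 ^ k))" by blast
  have "\<forall>t\<in>T. \<exists>U\<subseteq>M. finite U \<and> card U \<le> lam \<and>
      mcball t (r / 2 ^ k) \<subseteq> (\<Union>u\<in>U. mcball u (r / 2 ^ k / 2))"
  proof
    fix t assume "t \<in> T"
    then have "t \<in> M" "r / 2 ^ k > 0" using T(1) r by auto
    then show "\<exists>U\<subseteq>M. finite U \<and> card U \<le> lam \<and>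
        mcball t (r / 2 ^ k) \<subseteq> (\<Union>u\<in>U. mcball u (r / 2 ^ k / 2))"
      by (rule lam[unfolded doubling_with_def, THEN bspec, THEN spec, THEN mp])
  qed
  then obtain U where U: "\<And>t. t \<in> T \<Longrightarrow> U t \<subseteq> M \<and> finite (U t) \<and> card (U t) \<le> lam \<and>
      mcball t (r / 2 ^ k) \<subseteq> (\<Union>u\<in>U t. mcball u (r / 2 ^ k / 2))" by metis
  have "card (\<Union>t\<in>T. U t) \<le> (\<Sum>t\<in>T. card (U t))"
    by (rule card_UN_le[OF T(2)])
  also have "\<dots> \<le> card T * lam"
    using U sum_bounded_above[of T "\<lambda>t. card (U t)" lam] by simp
  also have "\<dots> \<le> lam ^ Suc k"
    using T(3) by (simp add: mult.commute)
  finally have "card (\<Union>t\<in>T. U t) \<le> lam ^ Suc k" .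
  moreover have "mcball x r \<subseteq> (\<Union>u\<in>(\<Union>t\<in>T. U t). mcball u (r / 2 ^ Suc k))"
  proof
    fix y assume "y \<in> mcball x r"
    then obtain t where t: "t \<in> T" "y \<in> mcball t (r / 2 ^ k)" using T(4) by blast
    then obtain u where "u \<in> U t" "y \<in> mcball u (r / 2 ^ k / 2)" using U by blast
    with t(1) show "y \<in> (\<Union>u\<in>(\<Union>t\<in>T. U t). mcball u (r / 2 ^ Suc k))"
      by (auto simp: divide_divide_eq_left mult.commute)
  qed
  ultimately show ?case
    using U T(2) by (intro exI[of _ "\<Union>t\<in>T. U t"]) auto
qed

text \<open>Two points in one covering ball are at most twice its radius apart. Hence sending each
  point of \<open>A\<close> to the center of a covering ball that contains it is injective.\<close>

lemma doubling_packing: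
  assumes lam: "doubling_with lam" and x: "x \<in> M" and r: "r > 0"
    and A: "A \<subseteq> mcball x r"
    and sep: "\<And>a b. a \<in> A \<Longrightarrow> b \<in> A \<Longrightarrow> a \<noteq> b \<Longrightarrow> d a b > 2 * (r / 2 ^ k)"
  shows "card A \<le> lam ^ k"
proof -
  obtain T where T: "T \<subseteq> M" "finite T" "card T \<le> lam ^ k"
      "mcball x r \<subseteq> (\<Union>t\<in>T. mcball t (r / 2 ^ k))"
    using doubling_cover_power[OF lam x r] by blast
  have "\<forall>a\<in>A. \<exists>t\<in>T. a \<in> mcball t (r / 2 ^ k)" using A T(4) by blast
  then obtain c where c: "\<And>a. a \<in> A \<Longrightarrow> c a \<in> T \<and> a \<in> mcball (c a) (r / 2 ^ k)" by metis
  have "inj_on c A"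
  proof (rule inj_onI, rule ccontr)
    fix a b assume ab: "a \<in> A" "b \<in> A" "c a = c b" "a \<noteq> b"
    have "d (c a) a \<le> r / 2 ^ k" "d (c a) b \<le> r / 2 ^ k" "a \<in> M" "b \<in> M" "c a \<in> M"
      using c[OF ab(1)] c[OF ab(2)] ab(3) by auto
    then have "d a b \<le> 2 * (r / 2 ^ k)"
      using triangle[of a "c a" b] commute[of a "c a"] by linarith
    with sep[OF ab(1,2,4)] show False by simp
  qed
  then have "card A \<le> card T"
    using c T(2) by (intro card_inj_on_le) auto
  with T(3) show ?thesis by simp
qed

text \<open>Links \<open>ddim\<close> to an actual covering constant. On an empty space the least
  constant would be 0 and its logarithm a mere default value; a point of \<open>M\<close> forces
  every cover of a ball around it to be nonempty.\<close>

lemma doubling_with_Least: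
  assumes doubling and "M \<noteq> {}"
  shows "doubling_with (LEAST lam. doubling_with lam)"
    and "(LEAST lam. doubling_with lam) \<ge> 1"
    and "real (LEAST lam. doubling_with lam) = 2 powr ddim"
proof -
  let ?lam = "LEAST lam. doubling_with lam"
  show 1: "doubling_with ?lam"
    using assms(1) unfolding doubling_def by (rule LeastI_ex)
  obtain x where x: "x \<in> M" using assms(2) by blast
  obtain T where T: "finite T" "card T \<le> ?lam ^ 1" "mcball x 1 \<subseteq> (\<Union>t\<in>T. mcball t (1 / 2 ^ 1))"
    using doubling_cover_power[OF 1 x zero_less_one, of 1] by blast
  have "x \<in> mcball x 1" using x by simp
  with T(3) have "T \<noteq> {}" by blast
  with T(1) have "card T \<ge> 1" by (simp add: Suc_leI card_gt_0_iff)
  with T(2) show 2: "?lam \<ge> 1" by simp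
  then show "real ?lam = 2 powr ddim" unfolding ddim_def by simp
qed

end

text \<open>The scale is the rounded-down value of \<open>log 2 (1 / x)\<close>, and
  \<open>g \<le> x\<close> bounds it independently of \<open>x\<close>. It is used with
  \<open>g\<close> the margin.\<close>

lemma ex_dyadic_scale:
  fixes x g :: real
  assumes "0 < g" "g \<le> x" "x \<le> 1"
  shows "\<exists>i\<le>nat \<lfloor>log 2 (1 / g)\<rfloor>. 1 / 2 ^ i / 2 < x \<and> x \<le> 1 / 2 ^ i"
proof -
  define i where "i = nat \<lfloor>log 2 (1 / x)\<rfloor>"
  have x: "x > 0" using assms by simp
  have nonneg: "log 2 (1 / x) \<ge> 0" using assms x by simp
  have "log 2 (1 / x) \<le> log 2 (1 / g)" using assms x by (simp add: frac_le)
  then have "i \<le> nat \<lfloor>log 2 (1 / g)\<rfloor>" unfolding i_def by (intro nat_mono floor_mono)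
  moreover have i: "real i \<le> log 2 (1 / x)" "log 2 (1 / x) < real (Suc i)"
    using nonneg unfolding i_def by linarith+
  have "2 powr real i \<le> 1 / x" "1 / x < 2 powr real (Suc i)"
    using i x le_log_iff[of 2 "1 / x" "real i"] log_less_iff[of 2 "1 / x" "real (Suc i)"] by simp_all
  then have "2 ^ i \<le> 1 / x" "1 / x < 2 ^ Suc i"
    by (simp_all only: powr_realpow zero_less_numeral)
  then have "1 / 2 ^ i / 2 < x" "x \<le> 1 / 2 ^ i"
    using x by (simp_all add: field_simps)
  ultimately show ?thesis by blast
qed

section \<open>Separation of the selected points\<close>

context training_set
begin

lemma dist_ne_pos: "p \<in> P \<Longrightarrow> 0 < d p (ne p)"
  using ne_enemy[of p] P_subset by (metis mdist_pos_less subsetD)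

lemma dist_le_1:
  assumes "p \<in> P" "q \<in> P"
  shows "d p q \<le> 1"
proof -
  have "(\<lambda>(p, q). d p q) (p, q) \<le> (SUP (p, q) \<in> P \<times> P. d p q)"
    using assms P_finite by (intro cSUP_upper bdd_above_finite finite_imageI) auto
  then show ?thesis using P_diameter by simp
qed

lemma margin_pos: "0 < margin"
  and margin_le: "p \<in> P \<Longrightarrow> margin \<le> d p (ne p)"
  unfolding margin_def using P_finite P_nonempty dist_ne_pos by auto

lemma voren_dist:
  assumes "0 \<le> \<alpha>" "R \<subseteq> P" "x \<in> voren \<alpha> p R" "y \<in> R"
  shows "d x (ne x) \<le> (1 + \<alpha>) * d x y"
proof -
  have x: "x \<in> P" "nn x R = p" using assms(3) unfolding voren_def by auto
  have p: "p \<in> R" using nn_in[OF x(1) assms(2)] x(2) assms(4) by blast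
  have py: "d x p \<le> d x y" using nn_nearest[OF x(1) assms(2,4)] x(2) by simp
  have "d x (ne x) \<le> (1 + \<alpha>) * d x p"
  proof (cases "l x = l p")
    case False
    then have "d x (ne x) \<le> d x p" using ne_nearest[of x p] x(1) p assms(2) by auto
    also have "\<dots> \<le> (1 + \<alpha>) * d x p" using assms(1) by (simp add: algebra_simps)
    finally show ?thesis .
  next
    case True
    have cd: "chromatic_density x R < ereal \<alpha>" using assms(3) True unfolding voren_def by auto
    have dnn: "d_nn x R = d x p" using x(2) unfolding d_nn_def by simp
    \<comment> \<open>At distance 0 the density is \<infinity> by convention, so a density below
      \<alpha> excludes that case and makes the division legitimate.\<close>
    with cd have pos: "d x p > 0"
      unfolding chromatic_density_def by (auto split: if_splits simp: order_less_le)
    \<comment> \<open>Enemies in \<open>R\<close> are enemies in \<open>P\<close>, hence no closer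
      than \<open>ne x\<close>; this also holds when \<open>R\<close> contains none and the infimum
      is \<infinity>.\<close>
    have "ereal (d x (ne x)) \<le> d_ne x R"
      unfolding d_ne_def using ne_nearest[OF x(1)] assms(2) by (intro INF_greatest) auto
    moreover have "d_ne x R / ereal (d x p) - 1 < ereal \<alpha>"
      using cd dnn pos unfolding chromatic_density_def by simp
    then have "d_ne x R \<le> ereal ((1 + \<alpha>) * d x p)"
      using pos by (cases "d_ne x R") (auto simp: field_simps one_ereal_def)
    ultimately show ?thesis using order_trans ereal_less_eq(3) by blast
  qed
  also have "\<dots> \<le> (1 + \<alpha>) * d x y" using py assms(1) by (intro mult_left_mono) auto
  finally show ?thesis .
qed

text \<open>Loop invariant. The clause on \<open>S\<close> carries the induction: it is what a point
  brings along when it moves from \<open>S\<close> to \<open>R\<close>. Of two points in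
  \<open>R\<close>, only the later one is known to satisfy its own bound, and since \<open>R\<close>
  does not record the order, the minimum appears.\<close>

lemma sfcnn_state_separated:
  assumes "sfcnn_state \<alpha> R S" "0 \<le> \<alpha>"
  shows "R \<subseteq> P \<and> S \<subseteq> P \<and> (\<forall>x\<in>S. \<forall>y\<in>R. d x (ne x) \<le> (1 + \<alpha>) * d x y) \<and>
    (\<forall>x\<in>R. \<forall>y\<in>R. x \<noteq> y \<longrightarrow> min (d x (ne x)) (d y (ne y)) \<le> (1 + \<alpha>) * d x y)"
  using assms(1)
proof induction
  case (init c)
  then show ?case by auto
next
  case (step R S x R' f)
  have R': "R' \<subseteq> P" using step by auto
  have "f p \<in> P \<and> (\<forall>y\<in>R'. d (f p) (ne (f p)) \<le> (1 + \<alpha>) * d (f p) y)"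
    if "p \<in> R'" "voren \<alpha> p R' \<noteq> {}" for p
    using step(4)[OF that] voren_dist[OF assms(2) R'] unfolding voren_def by blast
  moreover have "min (d u (ne u)) (d v (ne v)) \<le> (1 + \<alpha>) * d u v"
    if "u \<in> R'" "v \<in> R'" "u \<noteq> v" for u v
    using that step.IH step.hyps(2,3) by (auto simp: commute min_le_iff_disj)
  ultimately show ?case using R' by auto
qed

section \<open>Counting over nearest enemies and scales\<close>

lemma card_scale_class:
  assumes lam: "doubling_with lam" and \<alpha>: "0 \<le> \<alpha>" "4 * (1 + \<alpha>) \<le> 2 ^ k"
    and R: "R \<subseteq> P" and q: "q \<in> M" and r: "0 < r"
    and sep: "\<And>x y. x \<in> R \<Longrightarrow> y \<in> R \<Longrightarrow> x \<noteq> y \<Longrightarrow>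
      min (d x (ne x)) (d y (ne y)) \<le> (1 + \<alpha>) * d x y"
  shows "card {p \<in> R. ne p = q \<and> r / 2 < d p q \<and> d p q \<le> r} \<le> lam ^ k"
proof (rule doubling_packing[OF lam q r])
  show "{p \<in> R. ne p = q \<and> r / 2 < d p q \<and> d p q \<le> r} \<subseteq> mcball q r"
    using R P_subset q by (auto simp: commute)
next
  fix a b
  assume ab: "a \<in> {p \<in> R. ne p = q \<and> r / 2 < d p q \<and> d p q \<le> r}"
    "b \<in> {p \<in> R. ne p = q \<and> r / 2 < d p q \<and> d p q \<le> r}" "a \<noteq> b"
  \<comment> \<open>Both points have the same nearest enemy \<open>q\<close>, at distance more than
    \<open>r / 2\<close>, so the minimum in \<open>sep\<close> exceeds \<open>r / 2\<close>. The
    factor 4 in the choice of \<open>k\<close> is this 2 times the 2 demanded by the packing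
    lemma.\<close>
  then have "r / 2 < (1 + \<alpha>) * d a b" using sep[of a b] by auto
  then have "2 * r < 4 * ((1 + \<alpha>) * d a b)" by linarith
  also have "\<dots> = 4 * (1 + \<alpha>) * d a b" by (simp only: mult.assoc)
  also have "\<dots> \<le> 2 ^ k * d a b" using \<alpha>(2) by (intro mult_right_mono) auto
  finally show "d a b > 2 * (r / 2 ^ k)" by (simp add: field_simps)
qed

lemma card_sfcnn_le:
  assumes lam: "doubling_with lam" and \<alpha>: "0 \<le> \<alpha>" "4 * (1 + \<alpha>) \<le> 2 ^ k"
    and ret: "sfcnn_returns \<alpha> R"
  shows "card R \<le> kappa * Suc (nat \<lfloor>log 2 (1 / margin)\<rfloor>) * lam ^ k"
proof -
  let ?I = "ne ` P \<times> {..nat \<lfloor>log 2 (1 / margin)\<rfloor>}"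
  let ?A = "\<lambda>(q, i). {p \<in> R. ne p = q \<and> 1 / 2 ^ i / 2 < d p q \<and> d p q \<le> 1 / 2 ^ i}"
  have inv: "R \<subseteq> P" "\<And>x y. x \<in> R \<Longrightarrow> y \<in> R \<Longrightarrow> x \<noteq> y \<Longrightarrow>
      min (d x (ne x)) (d y (ne y)) \<le> (1 + \<alpha>) * d x y"
    using sfcnn_state_separated[OF ret[unfolded sfcnn_returns_def] \<alpha>(1)] by auto
  have "R \<subseteq> (\<Union>j\<in>?I. ?A j)"
  proof
    fix p assume p: "p \<in> R"
    with inv(1) have pP: "p \<in> P" by auto
    \<comment> \<open>The diameter bounds the distance by 1 and the margin bounds it from below, so
      finitely many scales, starting at 1, suffice.\<close>
    obtain i where "i \<le> nat \<lfloor>log 2 (1 / margin)\<rfloor>"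
        "1 / 2 ^ i / 2 < d p (ne p)" "d p (ne p) \<le> 1 / 2 ^ i"
      using ex_dyadic_scale[OF margin_pos margin_le[OF pP] dist_le_1[OF pP]] ne_enemy[OF pP] by blast
    with p pP show "p \<in> (\<Union>j\<in>?I. ?A j)" by (intro UN_I[of "(ne p, i)"]) auto
  qed
  moreover have "finite (\<Union>j\<in>?I. ?A j)"
    using P_finite inv(1) by (auto intro: finite_subset)
  ultimately have "card R \<le> card (\<Union>j\<in>?I. ?A j)" by (intro card_mono)
  also have "\<dots> \<le> (\<Sum>j\<in>?I. card (?A j))"
    using P_finite by (intro card_UN_le) auto
  also have "\<dots> \<le> card ?I * lam ^ k"
  proof -
    have "card (?A j) \<le> lam ^ k" if "j \<in> ?I" for j
    proof -
      obtain q i where j: "j = (q, i)" by (cases j)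
      then have "q \<in> M" using that ne_enemy P_subset by auto
      from card_scale_class[OF lam \<alpha> inv(1) this _ inv(2), of "1 / 2 ^ i"] j show ?thesis by simp
    qed
    then show ?thesis using sum_bounded_above[of ?I "\<lambda>j. card (?A j)" "lam ^ k"] by simp
  qed
  also have "card ?I = kappa * Suc (nat \<lfloor>log 2 (1 / margin)\<rfloor>)"
    unfolding kappa_def by (simp add: card_cartesian_product)
  finally show ?thesis .
qed

lemma card_sfcnn_bound:
  assumes doubling and D: "ddim \<le> D" and \<alpha>: "0 \<le> \<alpha>" and ret: "sfcnn_returns \<alpha> R"
  shows "real (card R) \<le> 2 * 2 powr (3 * D) *
    (real kappa * max 1 (log 2 (1 / margin)) * (1 + \<alpha>) powr (ddim + 1))"
proof -
  define lam where "lam = (LEAST lam. doubling_with lam)"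
  have "M \<noteq> {}" using P_subset P_nonempty by auto
  note lam = doubling_with_Least[OF assms(1) this, folded lam_def]
  \<comment> \<open>The least admissible \<open>k\<close> for the packing count. Rounding up adds
    less than 1 to \<open>2 + log 2 (1 + \<alpha>)\<close>, which yields the 3 in the
    constant.\<close>
  define k where "k = nat \<lceil>log 2 (4 * (1 + \<alpha>))\<rceil>"
  have log4: "log 2 (4 * (1 + \<alpha>)) = 2 + log 2 (1 + \<alpha>)"
  proof -
    have "log 2 (4::real) = 2" using log_pow_cancel[of 2 2] by simp
    then show ?thesis using \<alpha> log_mult[of 2 4 "1 + \<alpha>"] by (simp add: distrib_left)
  qed
  have log0: "log 2 (1 + \<alpha>) \<ge> 0" using \<alpha> by simp
  have k: "log 2 (4 * (1 + \<alpha>)) \<le> real k" "real k \<le> 3 + log 2 (1 + \<alpha>)"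
    using log4 log0 unfolding k_def by linarith+
  have "4 * (1 + \<alpha>) \<le> 2 powr real k"
    using k(1) \<alpha> by (simp add: log_le_iff)
  then have k2: "4 * (1 + \<alpha>) \<le> 2 ^ k" by (simp add: powr_realpow)
  have ddim0: "ddim \<ge> 0" using lam(2) unfolding ddim_def lam_def by simp
  have "real (lam ^ k) = 2 powr (ddim * real k)"
    using lam(3) by (simp add: powr_powr[symmetric] powr_realpow)
  also have "\<dots> \<le> 2 powr (3 * ddim + log 2 (1 + \<alpha>) * ddim)"
    using mult_left_mono[OF k(2) ddim0] by (simp add: algebra_simps)
  also have "\<dots> = 2 powr (3 * ddim) * (1 + \<alpha>) powr ddim"
    using \<alpha> by (simp add: powr_add powr_powr[symmetric])
  \<comment> \<open>Only the constant passes from \<open>ddim\<close> to \<open>D\<close>. As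
    \<open>1 + \<alpha>\<close> is at least 1, raising its exponent by 1 cannot decrease the
    power.\<close>
  also have "\<dots> \<le> 2 powr (3 * D) * (1 + \<alpha>) powr (ddim + 1)"
    using D ddim0 \<alpha> by (intro mult_mono powr_mono) auto
  finally have lamk: "real (lam ^ k) \<le> 2 powr (3 * D) * (1 + \<alpha>) powr (ddim + 1)" .
  \<comment> \<open>The scale 0 adds one to the logarithm; the maximum with 1 absorbs it at the cost
    of a factor 2.\<close>
  have scales: "real (Suc (nat \<lfloor>log 2 (1 / margin)\<rfloor>)) \<le> 2 * max 1 (log 2 (1 / margin))"
    by linarith
  have "real (card R) \<le> real (kappa * Suc (nat \<lfloor>log 2 (1 / margin)\<rfloor>) * lam ^ k)"
    using card_sfcnn_le[OF lam(1) \<alpha> k2 ret] by (simp only: of_nat_le_iff)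
  also have "\<dots> = real kappa * real (Suc (nat \<lfloor>log 2 (1 / margin)\<rfloor>)) * real (lam ^ k)"
    by (simp only: of_nat_mult)
  also have "\<dots> \<le> real kappa * (2 * max 1 (log 2 (1 / margin))) *
      (2 powr (3 * D) * (1 + \<alpha>) powr (ddim + 1))"
    using lamk scales by (intro mult_mono mult_left_mono) auto
  finally show ?thesis by (simp add: mult_ac)
qed

end

text \<open>\<open>C\<close> is chosen before the space and depends only on the bound
  \<open>D\<close>, which expresses that the doubling dimension counts as constant. The maximum with
  1 covers margins near 1: at margin 1 the logarithm is 0, although points are selected.\<close>

theorem theorem16:
  fixes D :: real
  shows "\<exists>C>0. \<forall>(M :: 'a set) d P (l :: 'a \<Rightarrow> 'c) ne nn \<alpha> R.
           training_set M d P l ne nn \<longrightarrow>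
           Metric_space.doubling M d \<longrightarrow>
           Metric_space.ddim M d \<le> D \<longrightarrow>
           0 \<le> \<alpha> \<longrightarrow>
           training_set.sfcnn_returns d P l nn \<alpha> R \<longrightarrow>
           real (card R) \<le>
             C * (real (training_set.kappa P ne)
                  * max 1 (log 2 (1 / training_set.margin d P ne))
                  * (1 + \<alpha>) powr (Metric_space.ddim M d + 1))"
  by (rule exI[of _ "2 * 2 powr (3 * D)"]) (simp add: training_set.card_sfcnn_bound)

end
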